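(* Let $\{P_n(x)\}_{n=0}^\infty$ be the sequence of monic orthogonal polynomials with respect to a quasi-definite linear functional $\mathcal{L}$, with $P_{-1}(x)=0$. Let $\mathcal{U}_n^Q(x;a_1)=\mathcal{U}_n(x;a_1)+\alpha_n\mathcal{U}_{n-1}(x;a_1)$, with constants $\alpha_n$, be a monic quasi-Uvarov polynomial of order one for some $a_1\in\mathbb{R}$. Further, suppose $\{\mathcal{G}_n(x;a_2)\}_{n=0}^\infty$ is the sequence of monic orthogonal polynomials with respect to the Geronimus transformation $\mathcal{L}^G$ of $\mathcal{L}$ at $a_2\in\mathbb{R}$. Then there exist sequences of constants $\{\zeta_n\}_{n=0}^\infty$, $\{\gamma_n\}_{n=0}^\infty$ and $\{\eta_n\}_{n=0}^\infty$ such that $$P_{n-1}(x)=\frac{x-\eta_n}{\zeta_nx-\gamma_n}\mathcal{G}_n(x;a_2)-\frac{x-a_1}{\zeta_nx-\gamma_n}\mathcal{U}_n^Q(x;a_1),\qquad n\ge0.$$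
   Context: A linear functional $\mathcal{L}$ on the polynomials with complex coefficients is quasi-definite if there is a sequence of monic polynomials $P_n$, $\deg P_n=n$, with $\mathcal{L}[P_nP_m]=0$ for $n\ne m$ and $\mathcal{L}[P_n^2]\ne0$. The Geronimus transformation of $\mathcal{L}$ at $a_2$ with a constant $M$ is $\mathcal{L}^G[p(x)]=\mathcal{L}\left[\frac{p(x)-p(a_2)}{x-a_2}\right]+Mp(a_2)$; it is assumed quasi-definite, and $\mathcal{G}_n(x;a_2)$ denotes its monic orthogonal polynomial of degree $n$ (Geronimus polynomial). The Uvarov transformation of $\mathcal{L}$ at $a_1$ with a constant $M$ (not necessarily the same one) is $\mathcal{L}^U[p(x)]=\mathcal{L}[p(x)]+Mp(a_1)$; it is assumed quasi-definite, and $\mathcal{U}_n(x;a_1)$ denotes its monic orthogonal polynomial of degree $n$ (Uvarov polynomial), with $\mathcal{U}_{-1}=0$.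
   Formalization: The denominator ζ_n x − γ_n may vanish identically for some n ≥ 2 (the claim fails otherwise); for such n only (x−η_n)G_n = (x−a_1)U_n^Q is asserted, and otherwise the formula holds wherever the denominator is nonzero. *)

theory Defs
  imports Complex_Main "HOL-Computational_Algebra.Polynomial"
begin

definition monic_ops :: "(complex poly \<Rightarrow> complex) \<Rightarrow> (nat \<Rightarrow> complex poly) \<Rightarrow> bool" where
  "monic_ops L P \<longleftrightarrow>
     (\<forall>n. degree (P n) = n \<and> lead_coeff (P n) = 1) \<and>
     (\<forall>n m. n \<noteq> m \<longrightarrow> L (P n * P m) = 0) \<and>
     (\<forall>n. L ((P n)\<^sup>2) \<noteq> 0)"

definition quasi_definite :: "(complex poly \<Rightarrow> complex) \<Rightarrow> bool" where
  "quasi_definite L \<longleftrightarrow> (\<exists>P. monic_ops L P)"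

(* The polynomial division is exact: x - a divides p(x) - p(a). *)
definition geronimus ::
  "(complex poly \<Rightarrow> complex) \<Rightarrow> complex \<Rightarrow> complex \<Rightarrow> complex poly \<Rightarrow> complex" where
  "geronimus L a M p = L ((p - [:poly p a:]) div [:- a, 1:]) + M * poly p a"

definition uvarov ::
  "(complex poly \<Rightarrow> complex) \<Rightarrow> complex \<Rightarrow> complex \<Rightarrow> complex poly \<Rightarrow> complex" where
  "uvarov L a M p = L p + M * poly p a"

(* prev P n is the term of index n - 1, with the convention that the term of index -1 is 0. *)
definition prev :: "(nat \<Rightarrow> complex poly) \<Rightarrow> nat \<Rightarrow> complex poly" where
  "prev P n = (case n of 0 \<Rightarrow> 0 | Suc m \<Rightarrow> P m)"

definition quasi_order_one ::
  "(nat \<Rightarrow> complex poly) \<Rightarrow> (nat \<Rightarrow> complex) \<Rightarrow> nat \<Rightarrow> complex poly" where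
  "quasi_order_one U \<alpha> n = U n + smult (\<alpha> n) (prev U n)"

end

theory Submission
  imports Defs
begin

text \<open>
  Since \<open>L\<^sup>G[(x - a\<^sub>2) p] = L[p]\<close> and \<open>L\<^sup>U[(x - a\<^sub>1) p] = L[(x - a\<^sub>1) p]\<close>, both \<open>\<G>\<^sub>n\<close> and
  \<open>(x - a\<^sub>1) \<U>\<^sub>n\<close> are \<open>L\<close>-orthogonal to the polynomials of degree below \<open>n - 1\<close>, so
  \<open>\<G>\<^sub>n = P\<^sub>n + A P\<^bsub>n-1\<^esub>\<close>, while \<open>(x - a\<^sub>1) \<U>\<^sub>n\<^sup>Q\<close> is a combination of
  \<open>P\<^bsub>n+1\<^esub>, \<dots>, P\<^bsub>n-2\<^esub>\<close>. The three-term recurrence, used upwards for \<open>P\<^bsub>n+1\<^esub>\<close> and downwards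
  for \<open>P\<^bsub>n-2\<^esub>\<close>, writes the latter as \<open>(x - \<eta>) P\<^sub>n + l(x) P\<^bsub>n-1\<^esub>\<close> with \<open>l\<close> linear. Subtracting it
  from \<open>(x - \<eta>) \<G>\<^sub>n\<close> leaves a linear multiple of \<open>P\<^bsub>n-1\<^esub>\<close>.
\<close>

section \<open>Linear functionals and the two transformations\<close>

lemma linear_functional_simps:
  fixes L :: "complex poly \<Rightarrow> complex"
  assumes "Vector_Spaces.linear smult (*) L"
  shows "L (p + q) = L p + L q" "L (p - q) = L p - L q" "L (smult c p) = c * L p"
    "L 0 = 0" "L (sum f A) = (\<Sum>a\<in>A. L (f a))"
proof -
  interpret Vector_Spaces.linear smult "(*)" L by fact
  show "L (p + q) = L p + L q" "L (p - q) = L p - L q" "L (smult c p) = c * L p"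
    "L 0 = 0" "L (sum f A) = (\<Sum>a\<in>A. L (f a))"
    by (simp_all add: add diff scale zero sum)
qed

lemma linear_functionalI:
  fixes L :: "complex poly \<Rightarrow> complex"
  assumes "\<And>p q. L (p + q) = L p + L q" "\<And>c p. L (smult c p) = c * L p"
  shows "Vector_Spaces.linear smult (*) L"
  using assms by unfold_locales (simp_all add: algebra_simps smult_add_right smult_add_left)

lemma linear_uvarov:
  assumes "Vector_Spaces.linear smult (*) L"
  shows "Vector_Spaces.linear smult (*) (uvarov L a M)"
  by (rule linear_functionalI)
    (simp_all add: uvarov_def linear_functional_simps[OF assms] algebra_simps)

lemma linear_geronimus:
  assumes "Vector_Spaces.linear smult (*) L"
  shows "Vector_Spaces.linear smult (*) (geronimus L a M)"
proof (rule linear_functionalI)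
  fix p q :: "complex poly" and c :: complex
  have "p + q - [:poly (p + q) a:] = (p - [:poly p a:]) + (q - [:poly q a:])"
    by (simp add: algebra_simps)
  then show "geronimus L a M (p + q) = geronimus L a M p + geronimus L a M q"
    unfolding geronimus_def
    by (simp only: poly_div_add_left linear_functional_simps[OF assms] poly_add)
      (simp add: algebra_simps)
  have "smult c p - [:poly (smult c p) a:] = smult c (p - [:poly p a:])"
    by (simp add: smult_diff_right)
  then show "geronimus L a M (smult c p) = c * geronimus L a M p"
    unfolding geronimus_def
    by (simp only: div_smult_left linear_functional_simps[OF assms] poly_smult)
      (simp add: algebra_simps)
qed

lemma uvarov_mult_linear: "uvarov L a M ([:- a, 1:] * p) = L ([:- a, 1:] * p)"
  by (simp add: uvarov_def)

text \<open>The product vanishes at \<open>a\<close>, so the subtracted constant and the mass term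
  drop out and the exact division returns \<open>p\<close>.\<close>

lemma geronimus_mult_linear: "geronimus L a M ([:- a, 1:] * p) = L p"
proof -
  have "[:- a, 1:] * p div [:- a, 1:] = p" by (rule nonzero_mult_div_cancel_left) simp
  then show ?thesis by (simp add: geronimus_def del: mult_pCons_left)
qed

section \<open>Expansions and the recurrence for monic orthogonal polynomials\<close>

lemma monic_opsD:
  assumes "monic_ops L P"
  shows "degree (P n) = n" "coeff (P n) n = 1" "n \<noteq> m \<Longrightarrow> L (P n * P m) = 0"
    "L (P n * P n) \<noteq> 0" "P n \<noteq> 0"
proof -
  show "degree (P n) = n" using assms by (simp add: monic_ops_def)
  then show "coeff (P n) n = 1" using assms unfolding monic_ops_def by metis
  then show "P n \<noteq> 0" by auto
  show "n \<noteq> m \<Longrightarrow> L (P n * P m) = 0" "L (P n * P n) \<noteq> 0"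
    using assms by (simp_all add: monic_ops_def power2_eq_square)
qed

lemma monic_ops_0: "monic_ops L P \<Longrightarrow> P 0 = 1"
  using monic_opsD(1,2)[of L P 0] by (auto elim: degree_eq_zeroE)

lemma monic_ops_1: "monic_ops L P \<Longrightarrow> \<exists>c. P 1 = [:c, 1:]"
  using monic_opsD(1,2)[of L P 1]
  by (intro exI[of _ "coeff (P 1) 0"] poly_eqI) (auto simp: coeff_pCons coeff_eq_0 split: nat.split)

lemma monic_ops_spans:
  assumes "monic_ops L P" "degree p < n"
  shows "\<exists>c. p = (\<Sum>j<n. smult (c j) (P j))"
  using assms(2)
proof (induction n arbitrary: p)
  case 0
  then show ?case by simp
next
  case (Suc n)
  let ?r = "p - smult (coeff p n) (P n)"
  show ?case
  \<comment> \<open>For \<open>n = 0\<close> the remainder \<open>?r\<close> is 0, whose degree is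
    not below 0, so the degree argument fails and constants are treated apart.\<close>
  proof (cases "n = 0")
    case True
    then obtain d where "p = [:d:]" using Suc.prems by (auto elim: degree_eq_zeroE)
    then show ?thesis using True monic_ops_0[OF assms(1)] by (intro exI[of _ "\<lambda>_. d"]) simp
  next
    case False
    have "degree ?r \<le> n"
      using Suc.prems by (intro degree_diff_le) (auto simp: monic_opsD(1)[OF assms(1)])
    moreover have "coeff ?r n = 0" by (simp add: monic_opsD(2)[OF assms(1)])
    ultimately have "degree ?r < n" using False
      by (metis degree_0 leading_coeff_0_iff nat_less_le neq0_conv)
    then obtain c where c: "?r = (\<Sum>j<n. smult (c j) (P j))" using Suc.IH by blast
    have "p = (\<Sum>j<Suc n. smult ((c(n := coeff p n)) j) (P j))"
      using c by (simp add: diff_eq_eq)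
    then show ?thesis by blast
  qed
qed

lemma monic_ops_orthogonal:
  assumes "Vector_Spaces.linear smult (*) L" "monic_ops L P" "degree p < n"
  shows "L (P n * p) = 0"
proof -
  obtain c where "p = (\<Sum>j<n. smult (c j) (P j))" using monic_ops_spans[OF assms(2,3)] by blast
  then show ?thesis
    by (simp add: sum_distrib_left linear_functional_simps[OF assms(1)] monic_opsD(3)[OF assms(2)])
qed

text \<open>Pairing an expansion of \<open>p\<close> with \<open>P j\<close> isolates the j-th
  coefficient, since L[P_j^2] is nonzero. Orthogonality below \<open>m\<close> thus leaves a window
  of \<open>k\<close> terms; it is applied with \<open>k\<close> equal to 2, 3 and 4.\<close>

lemma monic_ops_expand:
  assumes "Vector_Spaces.linear smult (*) L" "monic_ops L P"
    and "degree p < m + k" "\<And>j. j < m \<Longrightarrow> L (p * P j) = 0"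
  shows "p = (\<Sum>j\<in>{m..<m+k}. smult (L (p * P j) / L (P j * P j)) (P j))"
proof -
  obtain c where c: "p = (\<Sum>j<m+k. smult (c j) (P j))"
    using monic_ops_spans[OF assms(2,3)] by blast
  have L: "L (p * P i) = c i * L (P i * P i)" if "i < m + k" for i
  proof -
    have "L (p * P i) = (\<Sum>j<m+k. c j * L (P j * P i))"
      by (subst c) (simp add: sum_distrib_right linear_functional_simps[OF assms(1)])
    also have "\<dots> = (\<Sum>j<m+k. if j = i then c i * L (P i * P i) else 0)"
      by (intro sum.cong) (auto simp: monic_opsD(3)[OF assms(2)])
    finally show ?thesis using that by simp
  qed
  have c0: "c j = 0" if "j < m" for j
    using L[of j] assms(4)[OF that] that monic_opsD(4)[OF assms(2), of j] by simp
  have "p = (\<Sum>j\<in>{m..<m+k}. smult (c j) (P j))"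
    by (subst c, rule sum.mono_neutral_right) (auto simp: c0)
  also have "\<dots> = (\<Sum>j\<in>{m..<m+k}. smult (L (p * P j) / L (P j * P j)) (P j))"
    by (intro sum.cong) (auto simp: L monic_opsD(4)[OF assms(2)])
  finally show ?thesis .
qed

text \<open>Multiplication by x is symmetric for \<open>L\<close>, which confines x P_{n+1} to three
  terms. That \<open>c\<close> is nonzero allows solving for \<open>P n\<close>, the downward use of
  the recurrence.\<close>

lemma monic_ops_recurrence:
  assumes "Vector_Spaces.linear smult (*) L" "monic_ops L P"
  shows "\<exists>b c. c \<noteq> 0 \<and> P (Suc (Suc n)) = [:b, 1:] * P (Suc n) - smult c (P n)"
proof -
  note D = monic_opsD[OF assms(2)]
  let ?x = "[:0, 1:] :: complex poly"
  let ?q = "?x * P (Suc n)"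
  define c where "c = (\<lambda>j. L (?q * P j) / L (P j * P j))"
  have degx: "degree (?x * P j) = Suc j" for j
    by (subst degree_mult_eq) (use D in auto)
  have swap: "L (?q * P j) = L (P (Suc n) * (?x * P j))" for j
    by (simp only: ac_simps)
  have "?q = (\<Sum>j\<in>{n..<n+3}. smult (c j) (P j))" unfolding c_def
  proof (rule monic_ops_expand[OF assms])
    show "degree ?q < n + 3" by (simp only: degx)
    show "L (?q * P j) = 0" if "j < n" for j
      unfolding swap by (rule monic_ops_orthogonal[OF assms]) (use that degx[of j] in simp)
  qed
  then have q: "?q = smult (c n) (P n) + smult (c (Suc n)) (P (Suc n))
      + smult (c (Suc (Suc n))) (P (Suc (Suc n)))"
    by (simp add: numeral_3_eq_3)
  have "coeff ?q (Suc (Suc n)) = 1" by (simp add: D)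
  then have 1: "c (Suc (Suc n)) = 1"
    unfolding q by (simp add: D coeff_eq_0)
  \<comment> \<open>Both terms are monic of degree n + 1, so in L[P_{n+1} x P_n] the factor x P_n
    may be replaced by P_{n+1}. Hence \<open>c n\<close> is a quotient of nonzero norms.\<close>
  have "degree (?x * P n - P (Suc n)) < Suc n"
  proof -
    have "degree (?x * P n - P (Suc n)) \<le> Suc n"
      by (intro degree_diff_le) (use degx[of n] D in auto)
    moreover have "coeff (?x * P n - P (Suc n)) (Suc n) = 0" by (simp add: D)
    ultimately show ?thesis
      by (metis degree_0 leading_coeff_0_iff nat_less_le zero_less_Suc)
  qed
  then have "L (P (Suc n) * (?x * P n - P (Suc n))) = 0"
    by (rule monic_ops_orthogonal[OF assms])
  then have "L (?q * P n) = L (P (Suc n) * P (Suc n))"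
    unfolding swap by (simp add: right_diff_distrib linear_functional_simps[OF assms(1)])
  then have "c n \<noteq> 0" using D(4) by (simp add: c_def)
  moreover have "P (Suc (Suc n)) = [:- c (Suc n), 1:] * P (Suc n) - smult (c n) (P n)"
    using q 1 by (simp add: algebra_simps)
  ultimately show ?thesis by blast
qed

section \<open>Geronimus and quasi-Uvarov polynomials in the basis \<open>P\<close>\<close>

lemma geronimus_expand:
  assumes "Vector_Spaces.linear smult (*) L" "monic_ops L P"
    and "monic_ops (geronimus L a M) G"
  shows "\<exists>A. G (Suc n) = P (Suc n) + smult A (P n)"
proof -
  note D = monic_opsD[OF assms(2)] and DG = monic_opsD[OF assms(3)]
  define c where "c = (\<lambda>j. L (G (Suc n) * P j) / L (P j * P j))"
  have "G (Suc n) = (\<Sum>j\<in>{n..<n+2}. smult (c j) (P j))" unfolding c_def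
  proof (rule monic_ops_expand[OF assms(1,2)])
    show "degree (G (Suc n)) < n + 2" by (simp add: DG)
    fix j assume j: "j < n"
    have "degree ([:- a, 1:] * P j) = Suc j"
      by (subst degree_mult_eq) (use D in auto)
    then have "geronimus L a M (G (Suc n) * ([:- a, 1:] * P j)) = 0"
      by (intro monic_ops_orthogonal[OF linear_geronimus[OF assms(1)] assms(3)]) (use j in simp)
    moreover have "G (Suc n) * ([:- a, 1:] * P j) = [:- a, 1:] * (G (Suc n) * P j)"
      by (simp only: ac_simps)
    ultimately show "L (G (Suc n) * P j) = 0" by (simp only: geronimus_mult_linear)
  qed
  then have e: "G (Suc n) = smult (c n) (P n) + smult (c (Suc n)) (P (Suc n))"
    by (simp add: numeral_2_eq_2)
  have "coeff (G (Suc n)) (Suc n) = 1" by (simp add: DG)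
  then have "c (Suc n) = 1" unfolding e by (simp add: D coeff_eq_0)
  then show ?thesis using e by (auto simp: add.commute)
qed

text \<open>The factor x - a cancels the point mass but raises the degree of the test polynomial to
  j + 1, whence the bound \<open>Suc j < n\<close>.\<close>

lemma uvarov_orthogonal:
  assumes "Vector_Spaces.linear smult (*) L" "monic_ops L P"
    and "monic_ops (uvarov L a M) U" "Suc j < n"
  shows "L ([:- a, 1:] * U n * P j) = 0"
proof -
  note D = monic_opsD[OF assms(2)]
  have "degree ([:- a, 1:] * P j) = Suc j"
    by (subst degree_mult_eq) (use D in auto)
  then have "uvarov L a M (U n * ([:- a, 1:] * P j)) = 0"
    by (intro monic_ops_orthogonal[OF linear_uvarov[OF assms(1)] assms(3)]) (use assms(4) in simp)
  moreover have "U n * ([:- a, 1:] * P j) = [:- a, 1:] * (U n * P j)"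
    by (simp only: ac_simps)
  ultimately show ?thesis by (simp only: uvarov_mult_linear mult.assoc)
qed

lemma quasi_uvarov_expand:
  assumes "Vector_Spaces.linear smult (*) L" "monic_ops L P"
    and "monic_ops (uvarov L a M) U"
  shows "\<exists>b c d. [:- a, 1:] * quasi_order_one U \<alpha> (Suc (Suc n)) =
    P (Suc (Suc (Suc n))) + smult b (P (Suc (Suc n))) + smult c (P (Suc n)) + smult d (P n)"
proof -
  note D = monic_opsD[OF assms(2)] and DU = monic_opsD[OF assms(3)]
  let ?W = "quasi_order_one U \<alpha> (Suc (Suc n))"
  let ?q = "[:- a, 1:] * ?W"
  have W: "?W = U (Suc (Suc n)) + smult (\<alpha> (Suc (Suc n))) (U (Suc n))"
    by (simp add: quasi_order_one_def prev_def)
  have degW: "degree ?W \<le> Suc (Suc n)"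
    unfolding W by (intro degree_add_le) (auto simp: DU)
  have coeffW: "coeff ?W (Suc (Suc n)) = 1"
    unfolding W by (simp add: DU coeff_eq_0)
  define c where "c = (\<lambda>j. L (?q * P j) / L (P j * P j))"
  have "?q = (\<Sum>j\<in>{n..<n+4}. smult (c j) (P j))" unfolding c_def
  proof (rule monic_ops_expand[OF assms(1,2)])
    have "degree ?q \<le> degree [:- a, 1:] + degree ?W" by (rule degree_mult_le)
    then show "degree ?q < n + 4" using degW by simp
    \<comment> \<open>The lower term \<open>U (Suc n)\<close> is the restrictive one: it needs
      \<open>Suc j < Suc n\<close>.\<close>
    fix j assume j: "j < n"
    have "?q * P j = [:- a, 1:] * U (Suc (Suc n)) * P j
        + smult (\<alpha> (Suc (Suc n))) ([:- a, 1:] * U (Suc n) * P j)"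
      unfolding W by (simp only: ring_distribs mult_smult_left mult_smult_right)
    then show "L (?q * P j) = 0"
      using uvarov_orthogonal[OF assms] j
      by (simp only: linear_functional_simps[OF assms(1)]) simp
  qed
  then have e: "?q = smult (c n) (P n) + smult (c (Suc n)) (P (Suc n))
      + smult (c (Suc (Suc n))) (P (Suc (Suc n)))
      + smult (c (Suc (Suc (Suc n)))) (P (Suc (Suc (Suc n))))"
    by (simp add: eval_nat_numeral)
  have "coeff ?q (Suc (Suc (Suc n))) = 1"
    using degW coeffW by (simp add: coeff_eq_0)
  then have "c (Suc (Suc (Suc n))) = 1" unfolding e by (simp add: D coeff_eq_0)
  then show ?thesis using e by (auto simp: ac_simps)
qed

section \<open>The identity without denominators and its rational form\<close>

lemma quasi_uvarov_geronimus_identity: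
  assumes "Vector_Spaces.linear smult (*) L" "monic_ops L P"
    and "monic_ops (uvarov L a1 MU) U" "monic_ops (geronimus L a2 MG) G"
  shows "\<exists>\<zeta> \<gamma> \<eta>. [:- \<gamma>, \<zeta>:] * prev P n =
      [:- \<eta>, 1:] * G n - [:- a1, 1:] * quasi_order_one U \<alpha> n
    \<and> (\<zeta> = 0 \<and> \<gamma> = 0 \<longrightarrow> n \<ge> 2)"
proof -
  consider "n = 0" | "n = 1" | k where "n = Suc (Suc k)"
    by (metis One_nat_def not0_implies_Suc)
  then show ?thesis
  proof cases
    case 1
    \<comment> \<open>Here \<open>prev P 0\<close> is 0 and both other polynomials are 1, so \<eta>
      = a1 makes both sides vanish; \<gamma> = 1 merely keeps the linear factor nonzero.\<close>
    then show ?thesis using monic_ops_0[OF assms(3)] monic_ops_0[OF assms(4)]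
      by (intro exI[of _ 0] exI[of _ 1] exI[of _ a1]) (simp add: prev_def quasi_order_one_def)
  next
    case 2
    obtain g u where g: "G 1 = [:g, 1:]" and u: "U 1 = [:u, 1:]"
      using monic_ops_1[OF assms(3)] monic_ops_1[OF assms(4)] by blast
    \<comment> \<open>The right-hand side is linear for every \<open>\<eta>\<close>; this choice makes its slope 1.\<close>
    define \<eta> where "\<eta> = g + a1 - u - \<alpha> 1 - 1"
    have "[:- (\<eta> * g - a1 * (u + \<alpha> 1)), 1:] * prev P n =
        [:- \<eta>, 1:] * G n - [:- a1, 1:] * quasi_order_one U \<alpha> n"
      using 2 g u monic_ops_0[OF assms(2)] monic_ops_0[OF assms(3)]
      by (simp add: prev_def quasi_order_one_def \<eta>_def algebra_simps)
    then show ?thesis by (metis zero_neq_one)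
  next
    case (3 k)
    obtain A where A: "G n = P n + smult A (P (Suc k))"
      using geronimus_expand[OF assms(1,2,4)] 3 by blast
    obtain b c d where Q: "[:- a1, 1:] * quasi_order_one U \<alpha> n =
        P (Suc n) + smult b (P n) + smult c (P (Suc k)) + smult d (P k)"
      using quasi_uvarov_expand[OF assms(1-3)] 3 by blast
    obtain s t where up: "P (Suc n) = [:s, 1:] * P n - smult t (P (Suc k))"
      using monic_ops_recurrence[OF assms(1,2)] 3 by blast
    obtain v w where w: "w \<noteq> 0" and "P n = [:v, 1:] * P (Suc k) - smult w (P k)"
      using monic_ops_recurrence[OF assms(1,2)] 3 by blast
    then have "smult w (P k) = [:v, 1:] * P (Suc k) - P n" by simp
    then have "smult (inverse w) (smult w (P k)) = smult (inverse w) ([:v, 1:] * P (Suc k) - P n)"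
      by (rule arg_cong)
    then have down: "P k = smult (inverse w) ([:v, 1:] * P (Suc k) - P n)"
      using w by simp
    \<comment> \<open>Substituting \<open>down\<close> for \<open>P k\<close> contributes e P_n to
      the difference; \<eta> is chosen to cancel all multiples of \<open>P n\<close>, leaving only
      \<open>P (Suc k)\<close>.\<close>
    define e where "e = d * inverse w"
    define \<eta> where "\<eta> = e - s - b"
    have "[:- \<eta>, 1:] * G n - [:- a1, 1:] * quasi_order_one U \<alpha> n =
        [:- (A * \<eta> - t + c + e * v), A - e:] * P (Suc k)"
    proof (rule poly_eq_poly_eq_iff[THEN iffD1], rule ext)
      fix x
      show "poly ([:- \<eta>, 1:] * G n - [:- a1, 1:] * quasi_order_one U \<alpha> n) x =
        poly ([:- (A * \<eta> - t + c + e * v), A - e:] * P (Suc k)) x"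
        unfolding Q A up down by (simp add: \<eta>_def e_def algebra_simps)
    qed
    moreover have "prev P n = P (Suc k)" using 3 by (simp add: prev_def)
    ultimately show ?thesis using 3 by (metis Suc_le_mono le0 numeral_2_eq_2)
  qed
qed

text \<open>The quotients make sense only where the denominator is nonzero. Should it vanish
  identically, the second conjunct keeps the identity with denominators cleared, whose
  \<open>P\<close> term is then 0.\<close>

theorem theorem4p4:
  fixes L :: "complex poly \<Rightarrow> complex"
    and P U G :: "nat \<Rightarrow> complex poly"
    and \<alpha> :: "nat \<Rightarrow> complex"
    and a1 a2 :: real
    and M\<^sub>U M\<^sub>G :: complex
  assumes "Vector_Spaces.linear smult (*) L"
    and "quasi_definite L"
    and "monic_ops L P"
    and "quasi_definite (uvarov L (of_real a1) M\<^sub>U)"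
    and "monic_ops (uvarov L (of_real a1) M\<^sub>U) U"
    and "quasi_definite (geronimus L (of_real a2) M\<^sub>G)"
    and "monic_ops (geronimus L (of_real a2) M\<^sub>G) G"
  shows "\<exists>\<zeta> \<gamma> \<eta> :: nat \<Rightarrow> complex. \<forall>n.
      (\<forall>x. \<zeta> n * x - \<gamma> n \<noteq> 0 \<longrightarrow>
         poly (prev P n) x =
           (x - \<eta> n) / (\<zeta> n * x - \<gamma> n) * poly (G n) x
           - (x - of_real a1) / (\<zeta> n * x - \<gamma> n) * poly (quasi_order_one U \<alpha> n) x) \<and>
      (\<zeta> n = 0 \<and> \<gamma> n = 0 \<longrightarrow>
         n \<ge> 2 \<and> [:- \<eta> n, 1:] * G n = [:- of_real a1, 1:] * quasi_order_one U \<alpha> n)"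
proof -
  let ?W = "quasi_order_one U \<alpha>"
  \<comment> \<open>The constants exist for each n separately; choice assembles them into
    sequences.\<close>
  obtain \<zeta> \<gamma> \<eta> where id: "\<And>n. [:- \<gamma> n, \<zeta> n:] * prev P n =
      [:- \<eta> n, 1:] * G n - [:- of_real a1, 1:] * ?W n"
    and n2: "\<And>n. \<zeta> n = 0 \<and> \<gamma> n = 0 \<longrightarrow> n \<ge> 2"
    using quasi_uvarov_geronimus_identity[OF assms(1,3,5,7), where \<alpha> = \<alpha>] by metis
  show ?thesis
  proof (intro exI allI conjI impI)
    fix n x assume nz: "\<zeta> n * x - \<gamma> n \<noteq> 0"
    have "poly ([:- \<gamma> n, \<zeta> n:] * prev P n) x =
        poly ([:- \<eta> n, 1:] * G n - [:- of_real a1, 1:] * ?W n) x"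
      by (simp only: id)
    then have "(\<zeta> n * x - \<gamma> n) * poly (prev P n) x =
        (x - \<eta> n) * poly (G n) x - (x - of_real a1) * poly (?W n) x"
      by (simp add: algebra_simps)
    then show "poly (prev P n) x = (x - \<eta> n) / (\<zeta> n * x - \<gamma> n) * poly (G n) x
        - (x - of_real a1) / (\<zeta> n * x - \<gamma> n) * poly (?W n) x"
      using nz by (metis diff_divide_distrib nonzero_mult_div_cancel_left times_divide_eq_left)
  next
    fix n assume z: "\<zeta> n = 0 \<and> \<gamma> n = 0"
    then show "n \<ge> 2" using n2 by blast
    show "[:- \<eta> n, 1:] * G n = [:- of_real a1, 1:] * ?W n"
      using id[of n] z by (simp del: mult_pCons_left)
  qed
qed

end
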